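(* Let $m$ and $t\ge 7$ be positive integers satisfying $\binom{t-1}{3} + \binom{t-2}{2}\le m \le \binom{t}{3}$. Let $G$ be a $3$-graph with vertex set $[t]$ and $m$ edges. If all but one edge of $[t-1]^{(3)}$ are in $G$ and $G$ does not contain a clique of order $t-1$, then $G$ is dense.
   Context: For a finite set $V$, $V^{(3)}$ denotes the family of all $3$-element subsets of $V$; $[n]=\{1,\dots,n\}$. A $3$-graph $G$ consists of a finite vertex set $V(G)$ and an edge set $E(G)\subseteq V(G)^{(3)}$. $H$ is a subgraph of $G$ if $V(H)\subseteq V(G)$ and $E(H)\subseteq E(G)$. $[n]^{(3)}$ also denotes the complete $3$-graph on $[n]$. A clique of order $p$ is a complete $3$-graph on $p$ vertices; a $3$-graph contains a clique of order $p$ if it has a subgraph (on any $p$ of its vertices) that is complete. For a $3$-graph $G$ with vertex set $[n]$ and $\vec x=(x_1,\dots,x_n)\in\mathbb R^n$, let $\lambda(G,\vec x)=\sum_{e\in E(G)}\prod_{i\in e}x_i$. The Lagrangian of $G$ is $\lambda(G)=\max\{\lambda(G,\vec x): \sum_{i=1}^n x_i=1,\ x_i\ge 0 \text{ for all } i\}$ (and analogously for an arbitrary finite vertex set). A $3$-graph $G$ is dense if every proper subgraph $G'$ of $G$ satisfies $\lambda(G')<\lambda(G)$ (equivalently, no optimum weighting of $G$ has a zero coordinate). *)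

theory Defs
  imports "HOL-Analysis.Analysis" "HOL-Library.Ramsey"
begin

text \<open>\<open>[A]\<^bsup>k\<^esup>\<close> is \<^const>\<open>nsets\<close> from the library: the \<open>k\<close>-element subsets of \<open>A\<close>.\<close>

record 'a hypergraph =
  verts :: "'a set"
  edges :: "'a set set"

definition three_graph :: "'a hypergraph \<Rightarrow> bool" where
  "three_graph G \<longleftrightarrow> finite (verts G) \<and> edges G \<subseteq> [verts G]\<^bsup>3\<^esup>"

definition subgraph :: "'a hypergraph \<Rightarrow> 'a hypergraph \<Rightarrow> bool" where
  "subgraph H G \<longleftrightarrow> verts H \<subseteq> verts G \<and> edges H \<subseteq> edges G"

definition complete_three_graph :: "'a set \<Rightarrow> 'a hypergraph" where
  "complete_three_graph W = \<lparr>verts = W, edges = [W]\<^bsup>3\<^esup>\<rparr>"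

definition contains_clique :: "'a hypergraph \<Rightarrow> nat \<Rightarrow> bool" where
  "contains_clique G p \<longleftrightarrow>
     (\<exists>W. finite W \<and> card W = p \<and> subgraph (complete_three_graph W) G)"

text \<open>Weightings are total functions; only their values on the vertex set matter.\<close>

definition weightings :: "'a set \<Rightarrow> ('a \<Rightarrow> real) set" where
  "weightings V = {x. (\<forall>i\<in>V. 0 \<le> x i) \<and> (\<Sum>i\<in>V. x i) = 1}"

definition lagrange_poly :: "'a hypergraph \<Rightarrow> ('a \<Rightarrow> real) \<Rightarrow> real" where
  "lagrange_poly G x = (\<Sum>e\<in>edges G. \<Prod>i\<in>e. x i)"

text \<open>
  The maximum is written as a supremum; it is attained, see \<open>lagrangian_attained\<close> below.
  The graph without vertices has no weightings at all; its Lagrangian is set to \<open>0\<close>.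
\<close>

definition lagrangian :: "'a hypergraph \<Rightarrow> real" where
  "lagrangian G =
     (if verts G = {} then 0 else (SUP x\<in>weightings (verts G). lagrange_poly G x))"

definition dense :: "'a hypergraph \<Rightarrow> bool" where
  "dense G \<longleftrightarrow>
     (\<forall>H. three_graph H \<and> subgraph H G \<and> H \<noteq> G \<longrightarrow> lagrangian H < lagrangian G)"

lemma lagrangian_attained:
  assumes G: "three_graph G" and ne: "verts G \<noteq> {}"
  obtains x where "x \<in> weightings (verts G)" "lagrangian G = lagrange_poly G x"
    "\<And>y. y \<in> weightings (verts G) \<Longrightarrow> lagrange_poly G y \<le> lagrangian G"
proof -
  let ?V = "verts G"
  have fin: "finite ?V" and sub: "\<And>e. e \<in> edges G \<Longrightarrow> e \<subseteq> ?V"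
    using G by (auto simp: three_graph_def nsets_def)
  define B :: "('a \<Rightarrow> real) set" where
    "B = (\<Pi>\<^sub>E i\<in>UNIV. if i \<in> ?V then {0..1} else {0})"
  have "compactin (product_topology (\<lambda>i. euclidean) UNIV) B"
    unfolding B_def by (subst compactin_PiE) (auto simp: compactin_euclidean_iff)
  then have compB: "compact B"
    by (simp add: euclidean_product_topology compactin_euclidean_iff)
  define K where "K = B \<inter> {x. (\<Sum>i\<in>?V. x i) = 1}"
  have "closed {x :: 'a \<Rightarrow> real. (\<Sum>i\<in>?V. x i) = 1}"
    by (intro closed_Collect_eq continuous_intros continuous_on_product_coordinates)
  then have "compact K"
    unfolding K_def using compB by (rule compact_Int_closed[rotated])
  moreover obtain v where v: "v \<in> ?V" using ne by blast
  have "(\<lambda>i. if i = v then 1 else 0) \<in> K"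
    using v fin by (auto simp: K_def B_def)
  then have "K \<noteq> {}" by blast
  moreover have "continuous_on K (lagrange_poly G)"
    unfolding lagrange_poly_def
    by (intro continuous_intros continuous_on_subset[OF continuous_on_product_coordinates]) auto
  ultimately obtain x where x: "x \<in> K" "\<And>y. y \<in> K \<Longrightarrow> lagrange_poly G y \<le> lagrange_poly G x"
    using continuous_attains_sup by metis
  have xw: "x \<in> weightings ?V"
  proof -
    have "0 \<le> x i" if "i \<in> ?V" for i
      using x(1) that by (auto simp: K_def B_def PiE_iff split: if_splits dest!: spec[of _ i])
    then show ?thesis using x(1) by (auto simp: weightings_def K_def)
  qed
  have le: "lagrange_poly G y \<le> lagrange_poly G x" if y: "y \<in> weightings ?V" for y
  proof -
    define z where "z = (\<lambda>i. if i \<in> ?V then y i else 0)"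
    have "y i \<le> 1" if "i \<in> ?V" for i
      using member_le_sum[OF that, of y] y fin by (auto simp: weightings_def)
    then have "z \<in> K"
      using y by (auto simp: K_def B_def z_def weightings_def)
    moreover have "lagrange_poly G z = lagrange_poly G y"
      unfolding lagrange_poly_def z_def
      by (intro sum.cong prod.cong) (use sub in auto)
    ultimately show ?thesis using x(2) by metis
  qed
  have "lagrangian G = lagrange_poly G x"
    unfolding lagrangian_def using ne xw le by (auto intro!: cSup_eq_maximum)
  then show ?thesis using that xw le by metis
qed

end

theory Submission
  imports Defs
begin

text \<open>
  Write \<open>V = {1..t - 1}\<close> and let \<open>K\<close> be the complete 3-graph on \<open>V\<close> with its one missing edge
  \<open>e\<close> removed (a near-clique). Everything reduces to the strict inequality
  \<open>\<lambda>(K) < \<lambda>(G)\<close>. Indeed, if an optimal weighting of \<open>G\<close> vanished at a vertex \<open>v\<close>, then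
  \<open>\<lambda>(G)\<close> would be attained on \<open>G - v\<close>. This graph has \<open>t - 1\<close> vertices and is not complete,
  because \<open>G\<close> contains no clique of that order, so it embeds in a copy of \<open>K\<close> and
  \<open>\<lambda>(G) \<le> \<lambda>(K)\<close> (\<open>lagrangian_near_clique_le\<close>). Hence optimal weightings are positive on
  all vertices, and then deleting any edge or vertex costs something
  (\<open>dense_if_optima_positive\<close>).

  For the inequality one needs to know an optimal weighting of \<open>K\<close>. First-order conditions show
  that it takes one value \<open>a\<close> on \<open>e\<close> and another value \<open>b\<close> off \<open>e\<close>, with \<open>2b/3 < a \<le> b\<close>
  (\<open>near_clique_optimum\<close>). Now move a little weight from a vertex \<open>v\<close> outside \<open>e\<close> to the
  vertex \<open>t\<close>. If all pairs of \<open>V\<close> were in the link of \<open>t\<close>, the new vertex would have the link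
  of \<open>v\<close> and in addition the pairs containing \<open>v\<close>, which is worth \<open>b (1 - b)\<close> to first order.
  By the lower bound on \<open>m\<close> at most \<open>t - 3\<close> pairs are missing from the link, each of weight at most
  \<open>b\<^sup>2\<close>. Since the weights sum to \<open>1 = 3a + (t - 4)b\<close>, the net rate of gain is at least
  \<open>b (1 - b) - (t - 3) b\<^sup>2 = b (3a - 2b) > 0\<close> (\<open>lagrangian_extend_near_clique\<close>).
\<close>

section \<open>Elementary symmetric sums\<close>

definition esym :: "nat \<Rightarrow> 'a set \<Rightarrow> ('a \<Rightarrow> real) \<Rightarrow> real" where
  "esym k S x = (\<Sum>e\<in>[S]\<^bsup>k\<^esup>. \<Prod>i\<in>e. x i)"

lemma nsets_Suc_insert:
  assumes "finite S" "v \<notin> S"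
  shows "[insert v S]\<^bsup>Suc k\<^esup> = [S]\<^bsup>Suc k\<^esup> \<union> insert v ` [S]\<^bsup>k\<^esup>"
proof (intro equalityI subsetI)
  fix f assume f: "f \<in> [insert v S]\<^bsup>Suc k\<^esup>"
  show "f \<in> [S]\<^bsup>Suc k\<^esup> \<union> insert v ` [S]\<^bsup>k\<^esup>"
  proof (cases "v \<in> f")
    case True
    then have "f = insert v (f - {v})" "f - {v} \<in> [S]\<^bsup>k\<^esup>"
      using f by (auto simp: nsets_def)
    then show ?thesis by blast
  next
    case False
    then show ?thesis using f by (auto simp: nsets_def)
  qed
next
  fix f assume "f \<in> [S]\<^bsup>Suc k\<^esup> \<union> insert v ` [S]\<^bsup>k\<^esup>"
  then show "f \<in> [insert v S]\<^bsup>Suc k\<^esup>"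
  proof
    assume "f \<in> insert v ` [S]\<^bsup>k\<^esup>"
    then obtain g where g: "f = insert v g" "g \<subseteq> S" "finite g" "card g = k"
      by (auto simp: nsets_def)
    moreover have "v \<notin> g" using g assms by blast
    ultimately show ?thesis by (auto simp: nsets_def)
  qed (auto simp: nsets_def)
qed

lemma esym_Suc_insert:
  assumes "finite S" "v \<notin> S"
  shows "esym (Suc k) (insert v S) x = esym (Suc k) S x + x v * esym k S x"
proof -
  have fin: "finite ([S]\<^bsup>j\<^esup>)" for j
    using assms(1) by (rule finite_imp_finite_nsets)
  have disj: "[S]\<^bsup>Suc k\<^esup> \<inter> insert v ` [S]\<^bsup>k\<^esup> = {}"
    using assms(2) by (auto simp: nsets_def)
  have inj: "inj_on (insert v) ([S]\<^bsup>k\<^esup>)"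
    using assms(2) by (auto simp: inj_on_def nsets_def)
  have "(\<Sum>f\<in>insert v ` [S]\<^bsup>k\<^esup>. \<Prod>i\<in>f. x i) = (\<Sum>g\<in>[S]\<^bsup>k\<^esup>. x v * (\<Prod>i\<in>g. x i))"
    unfolding sum.reindex[OF inj] o_def
  proof (rule sum.cong)
    fix g assume "g \<in> [S]\<^bsup>k\<^esup>"
    then have "finite g" "v \<notin> g" using assms(2) by (auto simp: nsets_def)
    then show "(\<Prod>i\<in>insert v g. x i) = x v * (\<Prod>i\<in>g. x i)" by simp
  qed simp
  then show ?thesis
    unfolding esym_def nsets_Suc_insert[OF assms]
    by (simp add: sum.union_disjoint[OF fin finite_imageI[OF fin] disj] sum_distrib_left)
qed

lemma esym_1: "esym (Suc 0) S x = sum x S"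
  unfolding esym_def nsets_one by (simp add: sum.reindex)

lemma esym_cong:
  assumes "\<And>i. i \<in> S \<Longrightarrow> x i = y i"
  shows "esym k S x = esym k S y"
  unfolding esym_def using assms by (intro sum.cong prod.cong) (auto simp: nsets_def)

lemma esym3_remove:
  assumes "finite V" "v \<in> V"
  shows "esym 3 V x = esym 3 (V - {v}) x + x v * esym 2 (V - {v}) x"
  using esym_Suc_insert[of "V - {v}" v 2 x] assms by (simp add: insert_absorb numeral_3_eq_3)

lemma esym2_remove:
  assumes "finite V" "v \<in> V"
  shows "esym 2 V x = esym 2 (V - {v}) x + x v * sum x (V - {v})"
  using esym_Suc_insert[of "V - {v}" v 1 x] assms
  by (simp add: insert_absorb numeral_2_eq_2 esym_1)

lemma esym3_remove2:
  assumes "finite V" "i \<in> V" "j \<in> V" "i \<noteq> j"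
  shows "esym 3 V x = esym 3 (V - {i, j}) x + (x i + x j) * esym 2 (V - {i, j}) x
           + x i * x j * sum x (V - {i, j})"
proof -
  have "V - {i} - {j} = V - {i, j}" by blast
  then show ?thesis
    using esym3_remove[of V i x] esym3_remove[of "V - {i}" j x] esym2_remove[of "V - {i}" j x] assms
    by (simp add: algebra_simps)
qed

section \<open>Optimal weightings\<close>

lemma lagrange_poly_le_lagrangian:
  assumes "three_graph G" "verts G \<noteq> {}" "y \<in> weightings (verts G)"
  shows "lagrange_poly G y \<le> lagrangian G"
  using lagrangian_attained[OF assms(1,2)] assms(3) by metis

text \<open>
  An optimal weighting of a subgraph, extended by zero, is a weighting of \<open>G\<close>. If it is optimal for
  \<open>G\<close>, it is positive, so no vertex is missing from the subgraph, and every missing edge would have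
  contributed a positive term.
\<close>

lemma dense_if_optima_positive:
  assumes G: "three_graph G" "verts G \<noteq> {}" and pos: "0 < lagrangian G"
    and optima: "\<And>x v. x \<in> weightings (verts G) \<Longrightarrow> lagrange_poly G x = lagrangian G
                   \<Longrightarrow> v \<in> verts G \<Longrightarrow> 0 < x v"
  shows "dense G"
  unfolding dense_def
proof (intro allI impI, elim conjE)
  fix H assume H: "three_graph H" "subgraph H G" "H \<noteq> G"
  show "lagrangian H < lagrangian G"
  proof (cases "verts H = {}")
    case True
    then show ?thesis using pos by (simp add: lagrangian_def)
  next
    case False
    have sub: "verts H \<subseteq> verts G" "edges H \<subseteq> edges G"
      using H(2) by (auto simp: subgraph_def)
    have finG: "finite (verts G)" "finite (edges G)"
      using G(1) finite_subset[OF _ finite_imp_finite_nsets] by (auto simp: three_graph_def)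
    obtain y where y: "y \<in> weightings (verts H)" "lagrangian H = lagrange_poly H y"
      using lagrangian_attained[OF H(1) False] by metis
    define x where "x = (\<lambda>i. if i \<in> verts H then y i else 0)"
    have sum_x: "sum x (verts G) = sum y (verts H)"
      using sub(1) finG(1) unfolding x_def
      by (simp add: sum.If_cases Int_absorb1)
    have xw: "x \<in> weightings (verts G)"
      using y(1) sum_x by (auto simp: weightings_def x_def)
    have nonneg: "0 \<le> prod x f" if "f \<in> edges G" for f
      using that G(1) xw by (intro prod_nonneg) (auto simp: three_graph_def nsets_def weightings_def)
    have "lagrange_poly H y = (\<Sum>f\<in>edges H. prod x f)"
      unfolding lagrange_poly_def x_def using H(1)
      by (intro sum.cong prod.cong) (auto simp: three_graph_def nsets_def)
    then have val: "lagrange_poly H y + (\<Sum>f\<in>edges G - edges H. prod x f) = lagrange_poly G x"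
      unfolding lagrange_poly_def using sum.subset_diff[OF sub(2) finG(2), of "prod x"] by simp
    have le: "lagrange_poly G x \<le> lagrangian G"
      using lagrange_poly_le_lagrangian[OF G xw] .
    have rest: "0 \<le> (\<Sum>f\<in>edges G - edges H. prod x f)"
      using nonneg by (intro sum_nonneg) auto
    show ?thesis
    proof (rule ccontr)
      assume "\<not> lagrangian H < lagrangian G"
      then have opt: "lagrange_poly G x = lagrangian G"
        and zero: "(\<Sum>f\<in>edges G - edges H. prod x f) = 0"
        using val le rest y(2) by linarith+
      note xpos = optima[OF xw opt]
      have verts: "verts H = verts G"
        using sub(1) xpos by (force simp: x_def split: if_splits)
      have "edges G - edges H = {}"
      proof (rule ccontr)
        assume ne: "edges G - edges H \<noteq> {}"
        have "0 < (\<Sum>f\<in>edges G - edges H. prod x f)"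
        proof (rule sum_pos)
          show "0 < prod x f" if "f \<in> edges G - edges H" for f
            using that G(1) xpos by (intro prod_pos) (auto simp: three_graph_def nsets_def)
        qed (use finG ne in auto)
        then show False using zero by simp
      qed
      then have "H = G" using verts sub(2) by (intro hypergraph.equality) auto
      then show False using H(3) by simp
    qed
  qed
qed

text \<open>
  The Lagrange multiplier condition for a maximum over the simplex, specialised to two coordinates:
  if weight can be taken from \<open>j\<close>, then the partial derivative in direction \<open>i\<close> is at most that in
  direction \<open>j\<close>. Edge polynomials are affine in each single variable, so they have the form
  assumed of \<open>F\<close>, and the condition follows from moving an explicit small weight \<open>d\<close> from \<open>j\<close> to
  \<open>i\<close>.
\<close>

lemma optimum_first_order:
  assumes "finite V" "x \<in> weightings V" "i \<in> V" "j \<in> V" "i \<noteq> j"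
    and opt: "\<And>y. y \<in> weightings V \<Longrightarrow> F y \<le> F x"
    and F: "\<And>p q. F (x(i := p, j := q)) = \<alpha> + \<beta> * p + \<gamma> * q + A * (p * q)"
    and "0 < x j"
  shows "\<beta> + A * x j \<le> \<gamma> + A * (x i :: real)"
proof (rule ccontr)
  define D where "D = \<beta> + A * x j - \<gamma> - A * x i"
  assume "\<not> ?thesis"
  then have D: "0 < D" by (simp add: D_def)
  \<comment> \<open>The move changes \<open>F\<close> by \<open>d D - d\<^sup>2 A\<close>; the second term in the minimum makes this positive.\<close>
  define c where "c = 2 * (\<bar>A\<bar> + 1)"
  have c: "0 < c" by (simp add: c_def add_nonneg_pos)
  define d where "d = min (x j) (D / c)"
  have d: "0 < d" "d \<le> x j" using D c \<open>0 < x j\<close> by (simp_all add: d_def)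
  have "d \<le> D / c" by (simp add: d_def)
  then have dc: "d * c \<le> D" using c by (simp only: pos_le_divide_eq)
  have "d * A \<le> d * \<bar>A\<bar>" "0 \<le> d * \<bar>A\<bar>" using d(1) by simp_all
  moreover have "d * c = 2 * (d * \<bar>A\<bar>) + 2 * d" by (simp add: c_def algebra_simps)
  ultimately have small: "d * A < D" using d(1) dc by linarith
  define y where "y = x(i := x i + d, j := x j - d)"
  have "sum y V = sum x V"
  proof -
    have "sum z V = z i + z j + sum z (V - {i} - {j})" for z :: "_ \<Rightarrow> real"
      using assms(1,3-5) sum.remove[of V i z] sum.remove[of "V - {i}" j z] by simp
    moreover have "sum y (V - {i} - {j}) = sum x (V - {i} - {j})"
      by (intro sum.cong) (auto simp: y_def)
    moreover have "y i + y j = x i + x j" using assms(5) by (simp add: y_def)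
    ultimately show ?thesis by metis
  qed
  then have "y \<in> weightings V"
    using assms(2-5) d by (auto simp: weightings_def y_def)
  then have "F y \<le> F x" by (rule opt)
  moreover have "F y = \<alpha> + \<beta> * (x i + d) + \<gamma> * (x j - d) + A * ((x i + d) * (x j - d))"
    unfolding y_def by (rule F)
  moreover have "F x = \<alpha> + \<beta> * x i + \<gamma> * x j + A * (x i * x j)"
    using F[of "x i" "x j"] by simp
  ultimately have "d * (D - d * A) \<le> 0"
    by (simp add: D_def algebra_simps)
  then show False using d(1) small by (simp add: mult_le_0_iff)
qed

text \<open>
  If no edge lies inside \<open>T\<close>, a weighting concentrated on \<open>T\<close> has a zero factor in every edge.
\<close>

lemma weight_outside_pos:
  assumes "three_graph G" "x \<in> weightings (verts G)" "0 < lagrange_poly G x"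
    and T: "\<And>f. f \<in> edges G \<Longrightarrow> \<not> f \<subseteq> T"
  shows "0 < sum x (verts G - T)"
proof (rule ccontr)
  assume "\<not> ?thesis"
  moreover have nn: "0 \<le> x i" if "i \<in> verts G" for i
    using assms(2) that by (auto simp: weightings_def)
  then have "0 \<le> sum x (verts G - T)" by (intro sum_nonneg) auto
  ultimately have "sum x (verts G - T) = 0" by simp
  then have zero: "x i = 0" if "i \<in> verts G - T" for i
    using that nn assms(1) by (subst (asm) sum_nonneg_eq_0_iff) (auto simp: three_graph_def)
  have "prod x f = 0" if f: "f \<in> edges G" for f
  proof -
    obtain i where "i \<in> f" "i \<notin> T" using T[OF f] by blast
    moreover have "f \<subseteq> verts G" "finite f"
      using f assms(1) by (auto simp: three_graph_def nsets_def)
    ultimately show ?thesis using zero by (intro prod_zero) auto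
  qed
  then show False using assms(3) by (simp add: lagrange_poly_def)
qed

section \<open>A complete graph with one edge removed\<close>

definition near_clique :: "'a set \<Rightarrow> 'a set \<Rightarrow> 'a hypergraph" where
  "near_clique V e = \<lparr>verts = V, edges = [V]\<^bsup>3\<^esup> - {e}\<rparr>"

lemma near_clique_simps [simp]:
  "verts (near_clique V e) = V" "edges (near_clique V e) = [V]\<^bsup>3\<^esup> - {e}"
  by (simp_all add: near_clique_def)

lemma three_graph_near_clique: "finite V \<Longrightarrow> three_graph (near_clique V e)"
  by (auto simp: three_graph_def)

lemma lagrange_poly_near_clique:
  assumes "finite V" "e \<in> [V]\<^bsup>3\<^esup>"
  shows "lagrange_poly (near_clique V e) x = esym 3 V x - prod x e"
  using assms by (simp add: lagrange_poly_def esym_def sum_diff1 finite_imp_finite_nsets)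

lemma lagrangian_near_clique_pos:
  assumes "finite V" "4 \<le> card V"
  shows "0 < lagrangian (near_clique V e)"
proof -
  let ?x = "\<lambda>_. 1 / real (card V)"
  have V: "V \<noteq> {}" using assms by auto
  have fin: "finite ([V]\<^bsup>3\<^esup>)" using assms(1) by (rule finite_imp_finite_nsets)
  have "[V]\<^bsup>3\<^esup> - {e} \<noteq> {}"
  proof
    assume "[V]\<^bsup>3\<^esup> - {e} = {}"
    then have "card ([V]\<^bsup>3\<^esup>) \<le> 1"
      using card_mono[of "{e}" "[V]\<^bsup>3\<^esup>"] by auto
    moreover have "card V choose 3 \<ge> 4 choose 3" using assms(2) by (rule binomial_right_mono)
    ultimately show False by (simp add: eval_nat_numeral)
  qed
  then have "0 < lagrange_poly (near_clique V e) ?x"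
    unfolding lagrange_poly_def using fin assms V
    by (intro sum_pos) (auto intro!: prod_pos simp: card_gt_0_iff)
  also have "\<dots> \<le> lagrangian (near_clique V e)"
    using assms V
    by (intro lagrange_poly_le_lagrangian three_graph_near_clique) (auto simp: weightings_def)
  finally show ?thesis .
qed

text \<open>
  All near-cliques on the same number of vertices are isomorphic: glue a bijection of the removed
  edges to a bijection of their complements, and transport the weighting along the result.
\<close>

lemma lagrangian_near_clique_le:
  assumes V: "finite V" "e \<in> [V]\<^bsup>3\<^esup>" and W: "finite W" "e' \<in> [W]\<^bsup>3\<^esup>" and card: "card V = card W"
    and x: "x \<in> weightings W"
  shows "lagrange_poly (near_clique W e') x \<le> lagrangian (near_clique V e)"
proof -
  have e: "e \<subseteq> V" "finite e" "card e = 3" "e' \<subseteq> W" "finite e'" "card e' = 3"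
    using V(2) W(2) by (auto simp: nsets_def)
  obtain f where f: "bij_betw f e e'"
    using e by (metis finite_same_card_bij)
  obtain g where g: "bij_betw g (V - e) (W - e')"
    using e V(1) W(1) card
    by (metis card_Diff_subset finite_Diff finite_same_card_bij)
  define h where "h = (\<lambda>i. if i \<in> e then f i else g i)"
  have he: "bij_betw h e e'" and hr: "bij_betw h (V - e) (W - e')"
    using f g bij_betw_cong[of e h f] bij_betw_cong[of "V - e" h g] by (auto simp: h_def)
  have "bij_betw h (e \<union> (V - e)) (e' \<union> (W - e'))"
    using he hr by (rule bij_betw_combine) auto
  then have h: "bij_betw h V W" using e by (simp add: Un_absorb1)
  have all: "bij_betw (\<lambda>X. h ` X) ([V]\<^bsup>3\<^esup>) ([W]\<^bsup>3\<^esup>)"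
    using h by (rule bij_betw_nsets)
  have "h ` e = e'" using he by (simp add: bij_betw_def)
  then have "bij_betw (\<lambda>X. h ` X) {e} {e'}" by (simp add: bij_betw_def)
  with all have bij: "bij_betw (\<lambda>X. h ` X) ([V]\<^bsup>3\<^esup> - {e}) ([W]\<^bsup>3\<^esup> - {e'})"
    by (rule bij_betw_DiffI) (use V(2) W(2) in auto)
  have "lagrange_poly (near_clique W e') x = (\<Sum>X\<in>[V]\<^bsup>3\<^esup> - {e}. prod x (h ` X))"
    unfolding lagrange_poly_def using sum.reindex_bij_betw[OF bij, of "prod x"] by simp
  also have "\<dots> = lagrange_poly (near_clique V e) (x \<circ> h)"
    unfolding lagrange_poly_def near_clique_simps
  proof (rule sum.cong)
    fix X assume "X \<in> [V]\<^bsup>3\<^esup> - {e}"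
    then have "inj_on h X" using h by (auto simp: bij_betw_def nsets_def intro: inj_on_subset)
    then show "prod x (h ` X) = (\<Prod>i\<in>X. (x \<circ> h) i)" by (simp add: prod.reindex)
  qed simp
  also have "\<dots> \<le> lagrangian (near_clique V e)"
  proof (rule lagrange_poly_le_lagrangian)
    show "x \<circ> h \<in> weightings (verts (near_clique V e))"
      using x h sum.reindex_bij_betw[OF h, of x]
      by (auto simp: weightings_def bij_betw_def)
  qed (use V e in \<open>auto simp: three_graph_near_clique\<close>)
  finally show ?thesis .
qed

text \<open>
  For two vertices on the same side of the partition into \<open>e\<close> and its complement, the edge polynomial
  is symmetric in their weights, and the coefficient of the product of these weights is the total
  weight on a nonempty set of other vertices. That weight is positive, since all edges meet the set
  and the optimal value is positive; so the first-order condition makes the two weights equal.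
  Comparing a vertex \<open>u\<close> of \<open>e\<close> with a vertex \<open>v\<close> outside gives
  \<open>(b - a) (2a + (n - 4)b) \<le> a\<^sup>2\<close> for \<open>n = card V\<close>, with equality if \<open>a > 0\<close>. Equality rules out
  \<open>a > b\<close>, which would make the left side negative; and for \<open>a \<le> 2b/3\<close> the left side would be too large, being at least
  \<open>(2a + b) b / 3 > 2ab/3 \<ge> a\<^sup>2\<close>.
\<close>

lemma near_clique_optimum:
  assumes V: "finite V" "e \<in> [V]\<^bsup>3\<^esup>" "5 \<le> card V" and x: "x \<in> weightings V"
    and opt: "\<And>y. y \<in> weightings V
               \<Longrightarrow> lagrange_poly (near_clique V e) y \<le> lagrange_poly (near_clique V e) x"
  obtains a b where "\<And>i. i \<in> e \<Longrightarrow> x i = a" "\<And>i. i \<in> V - e \<Longrightarrow> x i = b"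
    "0 \<le> a" "0 < b" "a \<le> b" "2 * b < 3 * a" "3 * a + (real (card V) - 3) * b = 1"
proof -
  let ?F = "lagrange_poly (near_clique V e)"
  have F: "?F y = esym 3 V y - prod y e" for y
    using lagrange_poly_near_clique[OF V(1,2)] .
  have e: "e \<subseteq> V" "finite e" "card e = 3" using V(2) by (auto simp: nsets_def)
  have nn: "0 \<le> x i" if "i \<in> V" for i using x that by (auto simp: weightings_def)
  have pos: "0 < ?F x"
  proof -
    have "V \<noteq> {}" using V by auto
    then obtain z where "z \<in> weightings V" "lagrangian (near_clique V e) = ?F z"
      using lagrangian_attained[of "near_clique V e"] V(1)
      by (metis near_clique_simps(1) three_graph_near_clique)
    then show ?thesis
      using opt[of z] lagrangian_near_clique_pos[of V e] V by simp
  qed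
  have outside: "0 < sum x (V - T)" if "\<And>f. f \<in> [V]\<^bsup>3\<^esup> - {e} \<Longrightarrow> \<not> f \<subseteq> T" for T
    using weight_outside_pos[of "near_clique V e" x T] V x pos that
    by (simp add: three_graph_near_clique)
  have split: "?F (x(i := p, j := q)) = esym 3 (V - {i, j}) x + (p + q) * esym 2 (V - {i, j}) x
         + p * q * sum x (V - {i, j}) - prod (x(i := p, j := q)) e"
    if "i \<in> V" "j \<in> V" "i \<noteq> j" for i j p q
  proof -
    let ?y = "x(i := p, j := q)"
    have "esym k (V - {i, j}) ?y = esym k (V - {i, j}) x" for k
      by (rule esym_cong) auto
    moreover have "sum ?y (V - {i, j}) = sum x (V - {i, j})" by (rule sum.cong) auto
    ultimately show ?thesis using esym3_remove2[OF V(1) that, of ?y] that by (simp add: F)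
  qed
  have eq_if: "x i = x j" if A: "0 < A" and "i \<in> V" "j \<in> V" "i \<noteq> j"
    and ij: "\<And>p q. ?F (x(i := p, j := q)) = \<alpha> + \<beta> * p + \<beta> * q + A * (p * q)" for i j A \<alpha> \<beta>
  proof -
    have ji: "?F (x(j := q, i := p)) = \<alpha> + \<beta> * q + \<beta> * p + A * (q * p)" for p q
      using ij[of p q] that(4) by (simp add: fun_upd_twist algebra_simps)
    have "x j \<le> x i" if "0 < x j"
      using optimum_first_order[where F = ?F, OF V(1) x _ _ _ opt ij that] A
        \<open>i \<in> V\<close> \<open>j \<in> V\<close> \<open>i \<noteq> j\<close> by simp
    moreover have "x i \<le> x j" if "0 < x i"
      using optimum_first_order[where F = ?F, OF V(1) x _ _ _ opt ji that] A
        \<open>i \<in> V\<close> \<open>j \<in> V\<close> \<open>i \<noteq> j\<close> by simp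
    ultimately show ?thesis using nn[OF that(2)] nn[OF that(3)] by linarith
  qed
  have off: "x i = x j" if ij: "i \<in> V - e" "j \<in> V - e" "i \<noteq> j" for i j
  proof (rule eq_if)
    show "0 < sum x (V - {i, j})"
    proof (rule outside)
      show "\<not> f \<subseteq> {i, j}" if "f \<in> [V]\<^bsup>3\<^esup> - {e}" for f
        using that card_mono[of "{i, j}" f] ij(3) by (auto simp: nsets_def)
    qed
    show "?F (x(i := p, j := q)) = (esym 3 (V - {i, j}) x - prod x e)
        + esym 2 (V - {i, j}) x * p + esym 2 (V - {i, j}) x * q + sum x (V - {i, j}) * (p * q)" for p q
    proof -
      have "prod (x(i := p, j := q)) e = prod x e" using ij by (intro prod.cong) auto
      then show ?thesis using split[of i j p q] ij by (simp add: algebra_simps)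
    qed
  qed (use ij in auto)
  have on: "x i = x j" if ij: "i \<in> e" "j \<in> e" "i \<noteq> j" for i j
  proof -
    have "card (e - {i, j}) = 1" using e ij by (subst card_Diff_subset) auto
    then obtain l where l: "e - {i, j} = {l}" by (auto simp: card_1_singleton_iff)
    have lV: "l \<in> V - {i, j}" "V - {i, j} - {l} = V - e" using l e(1) ij by auto
    have prod_e: "prod z e = z i * z j * z l" for z :: "_ \<Rightarrow> real"
    proof -
      have "e = {i, j, l}" "l \<noteq> i" "l \<noteq> j" using l ij by auto
      then show ?thesis using ij(3) by simp
    qed
    show ?thesis
    proof (rule eq_if)
      show "0 < sum x (V - e)"
      proof (rule outside)
        show "\<not> f \<subseteq> e" if "f \<in> [V]\<^bsup>3\<^esup> - {e}" for f
          using that card_subset_eq[OF e(2), of f] e(3) by (auto simp: nsets_def)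
      qed
      show "?F (x(i := p, j := q)) = esym 3 (V - {i, j}) x
          + esym 2 (V - {i, j}) x * p + esym 2 (V - {i, j}) x * q + sum x (V - e) * (p * q)" for p q
      proof -
        have "sum x (V - {i, j}) = x l + sum x (V - e)"
          using sum.remove[of "V - {i, j}" l x] V(1) lV by simp
        moreover have "prod (x(i := p, j := q)) e = p * q * x l"
          using l ij by (subst prod_e) auto
        ultimately show ?thesis using split[of i j p q] ij e(1) by (auto simp: algebra_simps)
      qed
    qed (use ij e in auto)
  qed
  obtain u where u: "u \<in> e" using e by fastforce
  have "card (V - e) = card V - 3" using e by (simp add: card_Diff_subset)
  then obtain v where v: "v \<in> V - e"
    using V(3) by (cases "V - e = {}") auto
  define a b where "a = x u" and "b = x v"
  have xa: "x i = a" if "i \<in> e" for i using on[of i u] that u by (auto simp: a_def)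
  have xb: "x i = b" if "i \<in> V - e" for i using off[of i v] that v by (auto simp: b_def)
  have uv: "u \<in> V" "v \<in> V" "u \<noteq> v" using u v e by auto
  have a0: "0 \<le> a" and b0: "0 \<le> b" using nn uv by (auto simp: a_def b_def)
  have sum_off: "sum x (V - e) = (real (card V) - 3) * b"
    using xb \<open>card (V - e) = card V - 3\<close> V(3) by simp
  have total: "3 * a + (real (card V) - 3) * b = 1"
    using sum.subset_diff[OF e(1) V(1), of x] sum_off x xa e(3) by (simp add: weightings_def)
  have "0 < sum x (V - e)"
  proof (rule outside)
    show "\<not> f \<subseteq> e" if "f \<in> [V]\<^bsup>3\<^esup> - {e}" for f
      using that card_subset_eq[OF e(2), of f] e(3) by (auto simp: nsets_def)
  qed
  then have b: "0 < b" using sum_off b0 by (cases "b = 0") simp_all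
  define A where "A = sum x (V - {u, v})"
  have A: "A = 2 * a + (real (card V) - 4) * b"
  proof -
    have "V - {u} - {v} = V - {u, v}" by blast
    then have "sum x V = x u + (x v + A)"
      using uv V(1) sum.remove[of V u x] sum.remove[of "V - {u}" v x] by (simp add: A_def)
    then show ?thesis using x total by (simp add: weightings_def a_def b_def algebra_simps)
  qed
  have F_uv: "?F (x(u := p, v := q)) = esym 3 (V - {u, v}) x
      + (esym 2 (V - {u, v}) x - a\<^sup>2) * p + esym 2 (V - {u, v}) x * q + A * (p * q)" for p q
  proof -
    let ?y = "x(u := p, v := q)"
    have "prod ?y e = ?y u * prod ?y (e - {u})" using e u by (subst prod.remove[of e u]) auto
    also have "prod ?y (e - {u}) = (\<Prod>i\<in>e - {u}. a)"
      using v xa by (intro prod.cong) auto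
    also have "\<dots> = a\<^sup>2" using e u by simp
    also have "?y u = p" using uv by simp
    finally have "prod ?y e = p * a\<^sup>2" .
    then show ?thesis unfolding split[OF uv] A_def by (simp add: algebra_simps)
  qed
  have F_vu: "?F (x(v := q, u := p)) = esym 3 (V - {u, v}) x
      + esym 2 (V - {u, v}) x * q + (esym 2 (V - {u, v}) x - a\<^sup>2) * p + A * (q * p)" for p q
    using F_uv[of p q] uv(3) by (simp add: fun_upd_twist algebra_simps)
  have up: "A * (b - a) \<le> a\<^sup>2"
    using optimum_first_order[where F = ?F, OF V(1) x uv opt F_uv] b
    by (simp add: a_def b_def algebra_simps)
  have down: "a\<^sup>2 \<le> A * (b - a)" if "0 < a"
    using optimum_first_order[where F = ?F, OF V(1) x uv(2,1) uv(3)[symmetric] opt F_vu] that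
    by (simp add: a_def b_def algebra_simps)
  have card_b: "b \<le> (real (card V) - 4) * b"
    using V(3) b by simp
  then have "b \<le> A" using A a0 by linarith
  have ab: "a \<le> b"
  proof (rule ccontr)
    assume "\<not> a \<le> b"
    then have "A * (b - a) < 0" "0 < a" using b \<open>b \<le> A\<close> by (auto simp: mult_pos_neg)
    then show False using down by (smt (verit) zero_le_power2)
  qed
  have "2 * b < 3 * a"
  proof (rule ccontr)
    assume "\<not> 2 * b < 3 * a"
    then have "b / 3 \<le> b - a" "a \<le> 2 / 3 * b" by linarith+
    then have "(2 * a + b) * (b / 3) \<le> A * (b - a)"
      using A card_b a0 b by (intro mult_mono) linarith+
    moreover have "a * a \<le> a * (2 / 3 * b)" using a0 \<open>a \<le> 2 / 3 * b\<close> by (rule mult_left_mono[rotated])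
    moreover have "0 < b * b" using b by simp
    ultimately show False using up by (simp add: power2_eq_square algebra_simps)
  qed
  with xa xb a0 b ab total show thesis using that by blast
qed

section \<open>Adding a vertex to a near-clique\<close>

text \<open>
  The strict inequality behind the density theorem: a new vertex \<open>w\<close> increases the Lagrangian as long
  as few triples through \<open>w\<close> are missing. The edge \<open>e\<close> itself is one of the missing triples, so the
  bound on their number leaves at most \<open>card V - 2\<close> through \<open>w\<close>. The better weighting moves
  weight \<open>\<epsilon>\<close> to \<open>w\<close> from a vertex outside \<open>e\<close>, which leaves the product over \<open>e\<close> unchanged.
\<close>

lemma lagrangian_extend_near_clique:
  assumes V: "finite V" "5 \<le> card V" "w \<notin> V" "e \<in> [V]\<^bsup>3\<^esup>"
    and G: "three_graph G" "verts G = insert w V"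
    and missing: "[V]\<^bsup>3\<^esup> - edges G = {e}" "card ([insert w V]\<^bsup>3\<^esup> - edges G) < card V"
  shows "lagrangian (near_clique V e) < lagrangian G"
proof -
  define N where "N = [insert w V]\<^bsup>3\<^esup> - edges G"
  have finN: "finite N" using V(1) by (simp add: N_def finite_imp_finite_nsets)
  have V_ne: "V \<noteq> {}" using V by auto
  obtain x where x: "x \<in> weightings V"
      "lagrangian (near_clique V e) = lagrange_poly (near_clique V e) x"
      "\<And>y. y \<in> weightings V
         \<Longrightarrow> lagrange_poly (near_clique V e) y \<le> lagrange_poly (near_clique V e) x"
    using lagrangian_attained[OF three_graph_near_clique[OF V(1), of e]] V_ne
    by (metis near_clique_simps(1))
  obtain a b where ab: "\<And>i. i \<in> e \<Longrightarrow> x i = a" "\<And>i. i \<in> V - e \<Longrightarrow> x i = b"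
      "0 \<le> a" "0 < b" "a \<le> b" "2 * b < 3 * a" "3 * a + (real (card V) - 3) * b = 1"
    using near_clique_optimum[OF V(1,4,2) x(1,3)] by blast
  have e: "e \<subseteq> V" "finite e" "card e = 3" using V(4) by (auto simp: nsets_def)
  have "card (V - e) = card V - 3" using e by (simp add: card_Diff_subset)
  then have "V - e \<noteq> {}" using V(2) by (cases "V - e = {}") auto
  then obtain v where v: "v \<in> V - e" by blast
  \<comment> \<open>\<open>d\<close> bounds the first-order gain per unit of moved weight from below, and the second-order
    loss is at most \<open>\<epsilon>\<close> per unit, so any positive \<open>\<epsilon> < d\<close> not exceeding the weight \<open>b\<close> of \<open>v\<close>
    works.\<close>
  define d where "d = b * (3 * a - 2 * b)"
  have d: "0 < d" using ab by (simp add: d_def)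
  define \<epsilon> where "\<epsilon> = min b (d / 2)"
  have \<epsilon>: "0 < \<epsilon>" "\<epsilon> \<le> b" "\<epsilon> < d" using d ab by (auto simp: \<epsilon>_def)
  define y where "y = x(v := b - \<epsilon>, w := \<epsilon>)"
  have vw: "v \<in> V" "v \<noteq> w" "x v = b" using v V(3) ab by auto
  have y_off: "y i = x i" if "i \<in> V - {v}" for i using that V(3) by (auto simp: y_def)
  have yv: "y v = b - \<epsilon>" and yw: "y w = \<epsilon>" using vw by (auto simp: y_def)
  have y_bounds: "0 \<le> y i" "y i \<le> b" if "i \<in> V" for i
  proof -
    have "0 \<le> x i \<and> x i \<le> b" using that ab(1-5) by (cases "i \<in> e") auto
    then show "0 \<le> y i" "y i \<le> b" using \<epsilon> y_off[of i] yv that by (cases "i = v"; simp)+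
  qed
  have rest: "sum x (V - {v}) = 1 - b"
    using sum.remove[of V v x] V(1) vw x(1) by (simp add: weightings_def)
  have y_rest: "sum y (V - {v}) = 1 - b" "esym k (V - {v}) y = esym k (V - {v}) x" for k
    unfolding rest[symmetric] by (rule sum.cong[OF refl y_off] esym_cong[OF y_off]; assumption)+
  have "y \<in> weightings (insert w V)"
    using y_bounds(1) y_rest(1) \<epsilon> V sum.remove[of V v y] vw yv yw
    by (auto simp: weightings_def)
  then have "lagrange_poly G y \<le> lagrangian G"
    using lagrange_poly_le_lagrangian[OF G(1)] G(2) by simp
  moreover have "lagrange_poly (near_clique V e) x < lagrange_poly G y"
  proof -
    have "lagrange_poly G y = esym 3 (insert w V) y - (\<Sum>f\<in>N. prod y f)"
    proof -
      have "edges G \<subseteq> [insert w V]\<^bsup>3\<^esup>" using G by (simp add: three_graph_def)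
      then show ?thesis
        using sum.subset_diff[of "edges G" "[insert w V]\<^bsup>3\<^esup>" "prod y"] V(1)
        by (simp add: lagrange_poly_def esym_def N_def finite_imp_finite_nsets)
    qed
    also have "esym 3 (insert w V) y = esym 3 V y + \<epsilon> * esym 2 V y"
      using esym3_remove[of "insert w V" w y] V yw by simp
    also have "(\<Sum>f\<in>N. prod y f) = prod x e + (\<Sum>f\<in>N - {e}. prod y f)"
    proof -
      have "e \<in> N" using missing(1) V(4) by (auto simp: N_def nsets_def)
      moreover have "prod y e = prod x e" using v e by (intro prod.cong y_off) auto
      ultimately show ?thesis using finN by (simp add: sum.remove)
    qed
    also have "esym 3 V y = esym 3 (V - {v}) x + (b - \<epsilon>) * esym 2 (V - {v}) x"
      using esym3_remove[OF V(1) vw(1), of y] y_rest yv by simp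
    also have "esym 2 V y = esym 2 (V - {v}) x + (b - \<epsilon>) * (1 - b)"
      using esym2_remove[OF V(1) vw(1), of y] y_rest yv by simp
    finally have Gy: "lagrange_poly G y = esym 3 (V - {v}) x + b * esym 2 (V - {v}) x - prod x e
        + \<epsilon> * ((b - \<epsilon>) * (1 - b)) - (\<Sum>f\<in>N - {e}. prod y f)"
      by (simp add: algebra_simps)
    have "prod y f \<le> \<epsilon> * b\<^sup>2" if f: "f \<in> N - {e}" for f
    proof -
      have f3: "f \<subseteq> insert w V" "finite f" "card f = 3" "f \<notin> edges G" "f \<noteq> e"
        using f by (auto simp: N_def nsets_def)
      have wf: "w \<in> f" using missing(1) f3 by (auto simp: nsets_def)
      have "prod y f = \<epsilon> * prod y (f - {w})" using f3 wf yw by (simp add: prod.remove)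
      also have "prod y (f - {w}) \<le> (\<Prod>i\<in>f - {w}. b)"
        using y_bounds f3 by (intro prod_mono) auto
      also have "\<dots> = b\<^sup>2" using f3 wf by simp
      finally show ?thesis using \<epsilon>(1) by simp
    qed
    then have "(\<Sum>f\<in>N - {e}. prod y f) \<le> real (card (N - {e})) * (\<epsilon> * b\<^sup>2)"
      by (rule sum_bounded_above)
    also have "\<dots> \<le> (real (card V) - 2) * (\<epsilon> * b\<^sup>2)"
    proof (rule mult_right_mono)
      have "e \<in> N" using missing(1) V(4) by (auto simp: N_def nsets_def)
      then have "card (N - {e}) + 2 \<le> card V"
        using missing(2) finN V(2) unfolding N_def[symmetric] by (simp add: card_Diff_singleton)
      then show "real (card (N - {e})) \<le> real (card V) - 2" by linarith
    qed (use \<epsilon> in auto)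
    finally have bound: "(\<Sum>f\<in>N - {e}. prod y f) \<le> (real (card V) - 2) * (\<epsilon> * b\<^sup>2)" .
    have "\<epsilon> * ((b - \<epsilon>) * (1 - b)) - (real (card V) - 2) * (\<epsilon> * b\<^sup>2)
        = \<epsilon> * (b * (1 - b - (real (card V) - 2) * b) - \<epsilon> * (1 - b))"
      by (simp add: algebra_simps power2_eq_square)
    also have "1 - b - (real (card V) - 2) * b = 3 * a - 2 * b"
      using ab(7) by (simp add: algebra_simps)
    also have "\<epsilon> * (b * (3 * a - 2 * b) - \<epsilon> * (1 - b)) > 0"
    proof -
      have "\<epsilon> * (1 - b) \<le> \<epsilon> * 1" using \<epsilon> ab(4) by (intro mult_left_mono) auto
      then have "\<epsilon> * (1 - b) < d" using \<epsilon>(3) by linarith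
      then show ?thesis using \<epsilon>(1) by (simp add: d_def)
    qed
    finally have gain: "0 < \<epsilon> * ((b - \<epsilon>) * (1 - b)) - (real (card V) - 2) * (\<epsilon> * b\<^sup>2)" .
    have "lagrange_poly (near_clique V e) x
        = esym 3 (V - {v}) x + b * esym 2 (V - {v}) x - prod x e"
      using lagrange_poly_near_clique[OF V(1,4), of x] esym3_remove[OF V(1) vw(1), of x] vw(3)
      by simp
    then show ?thesis using Gy bound gain by linarith
  qed
  ultimately show ?thesis using x(2) by linarith
qed

section \<open>The density theorem\<close>

theorem theorem4p5:
  fixes m t :: nat and G :: "nat hypergraph"
  assumes "t \<ge> 7" and "m > 0"
    and "((t - 1) choose 3) + ((t - 2) choose 2) \<le> m" and "m \<le> t choose 3"
    and "three_graph G" and "verts G = {1..t}" and "card (edges G) = m"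
    and "card ([{1..t - 1}]\<^bsup>3\<^esup> - edges G) = 1"
    and "\<not> contains_clique G (t - 1)"
  shows "dense G"
proof -
  let ?V = "{1..t - 1}"
  have insert_V: "insert t ?V = {1..t}" using assms(1) by auto
  obtain e where e: "[?V]\<^bsup>3\<^esup> - edges G = {e}"
    using assms(8) by (auto simp: card_1_singleton_iff)
  then have eV: "e \<in> [?V]\<^bsup>3\<^esup>" by blast
  have sub: "edges G \<subseteq> [{1..t}]\<^bsup>3\<^esup>" using assms(5,6) by (simp add: three_graph_def)
  \<comment> \<open>By Pascal's rule, \<open>t choose 3\<close> exceeds the lower bound on \<open>m\<close> by exactly \<open>t - 2\<close>.\<close>
  have few: "card ([{1..t}]\<^bsup>3\<^esup> - edges G) < card ?V"
  proof -
    have "finite (edges G)" using sub by (rule finite_subset) (simp add: finite_imp_finite_nsets)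
    then have "card ([{1..t}]\<^bsup>3\<^esup> - edges G) = (t choose 3) - m"
      using sub assms(7) by (simp add: card_Diff_subset)
    moreover define s where "s = t - 2"
    then have "t = Suc (Suc s)" using assms(1) by simp
    then have "t choose 3 = ((t - 1) choose 3) + ((t - 2) choose 2) + (t - 2)"
      by (simp add: numeral_3_eq_3 numeral_2_eq_2)
    ultimately show ?thesis using assms(1,3) unfolding card_atLeastAtMost by linarith
  qed
  have extend: "lagrangian (near_clique ?V e) < lagrangian G"
    using lagrangian_extend_near_clique[of ?V t e G] assms(1,5,6) eV e few
    by (simp only: insert_V) auto
  have pos: "0 < lagrangian G"
  proof -
    have "0 < lagrangian (near_clique ?V e)"
      by (rule lagrangian_near_clique_pos) (use assms(1) in auto)
    then show ?thesis using extend by linarith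
  qed
  show ?thesis
  proof (rule dense_if_optima_positive)
    fix x v
    assume x: "x \<in> weightings (verts G)" "lagrange_poly G x = lagrangian G" and v: "v \<in> verts G"
    show "0 < x v"
    proof (rule ccontr)
      assume "\<not> 0 < x v"
      then have xv: "x v = 0" using x(1) v by (auto simp: weightings_def)
      define W where "W = verts G - {v}"
      have finW: "finite W" and cardW: "card W = t - 1"
        using v assms(6) by (simp_all add: W_def)
      have "\<not> [W]\<^bsup>3\<^esup> \<subseteq> edges G"
        using assms(9) finW cardW
        by (auto simp: contains_clique_def subgraph_def complete_three_graph_def W_def)
      then obtain f where f: "f \<in> [W]\<^bsup>3\<^esup>" "f \<notin> edges G" by blast
      have xW: "x \<in> weightings W"
        using x(1) xv v assms(6) by (auto simp: weightings_def W_def sum.remove)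
      have "lagrange_poly G x = (\<Sum>g\<in>{g \<in> edges G. v \<notin> g}. prod x g)"
        unfolding lagrange_poly_def
      proof (rule sum.mono_neutral_right)
        show "finite (edges G)" using sub by (rule finite_subset) (simp add: finite_imp_finite_nsets)
        show "\<forall>g\<in>edges G - {g \<in> edges G. v \<notin> g}. prod x g = 0"
          using xv sub by (auto simp: nsets_def intro!: prod_zero)
      qed auto
      also have "\<dots> \<le> lagrange_poly (near_clique W f) x"
        unfolding lagrange_poly_def near_clique_simps
      proof (rule sum_mono2)
        show "{g \<in> edges G. v \<notin> g} \<subseteq> [W]\<^bsup>3\<^esup> - {f}"
          using sub f assms(6) by (auto simp: nsets_def W_def)
        show "0 \<le> prod x g" if "g \<in> [W]\<^bsup>3\<^esup> - {f} - {g \<in> edges G. v \<notin> g}" for g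
          using that xW by (intro prod_nonneg) (auto simp: nsets_def weightings_def)
      qed (simp add: finW finite_imp_finite_nsets)
      also have "\<dots> \<le> lagrangian (near_clique ?V e)"
        using lagrangian_near_clique_le[OF _ eV finW f(1) _ xW] cardW by simp
      finally show False using extend x(2) by simp
    qed
  qed (use assms(1,5,6) pos in auto)
qed

end
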